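(* Let $A$ be a finite involutively closed alphabet and let $G$ be a group generated by $A$ whose word problem $WP(G;A)$ is the intersection of $k$ context-free languages accepted by rooted $A$-graphs $(\Gamma^{(1)},x_1),\ldots,(\Gamma^{(k)},x_k)$, i.e. \[ WP(G;A)=\bigcap_{i=1}^k L(\Gamma^{(i)},x_i). \] Then $G\simeq\mathcal{G}(\Gamma^{(1)}\sqcup\cdots\sqcup\Gamma^{(k)})$, and in particular $G$ belongs to the class $\mathbf{CF\text{-}TR}$.
   Context: Let $A$ be a finite alphabet closed under a formal inversion $a\mapsto a^{-1}$ ($a^{-1}\ne a$, $(a^{-1})^{-1}=a$), $A^*$ the free monoid on $A$, and $F_A$ the free group whose elements are the reduced words over $A$. For a group $G$ generated by (the image of) $A$, with $a^{-1}$ mapping to the inverse of the image of $a$, $WP(G;A)\subseteq A^*$ is the set of words representing the identity. An $A$-graph is a connected directed graph $\Gamma$ with vertex set $V(\Gamma)$, edges labeled by letters of $A$, and a fixed-point-free involution $e\mapsto e^{-1}$ on edges which exchanges initial and terminal vertices and inverts labels, and which is deterministic: for each vertex $v$ and each $a\in A$ there is at most one edge labeled $a$ starting at $v$. It is complete if for each $v$ and $a$ there is at least one such edge. A rooted $A$-graph $(\Gamma,x_0)$ is an $A$-graph with a distinguished vertex; the language it accepts is $L(\Gamma,x_0)\subseteq A^*$, the set of labels of circuits at $x_0$ (walks from $x_0$ to $x_0$). $\Gamma$ is context-free if $L(\Gamma,x_0)$ is a context-free language for some (equivalently, every) vertex $x_0$. For complete $A$-graphs $\Gamma^{(1)},\ldots,\Gamma^{(k)}$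 the transition group $\mathcal{G}(\Gamma^{(1)}\sqcup\cdots\sqcup\Gamma^{(k)})$ is the quotient of $F_A$ by the normal subgroup defined by $\bigcap_{i}\bigcap_{p\in V(\Gamma^{(i)})}L(\Gamma^{(i)},p)$; equivalently, it is the group of permutations of the disjoint union of the sets $V(\Gamma^{(i)})$ generated by the permutations induced by the letters of $A$. (In the claim the hypothesis forces each $\Gamma^{(i)}$ to be complete, so the transition group is defined.) $\mathbf{CF\text{-}TR}$ is the class of all groups isomorphic to $\mathcal{G}(\Gamma^{(1)}\sqcup\cdots\sqcup\Gamma^{(k)})$ for some finite involutively closed alphabet $A$ and some finite collection of complete context-free $A$-graphs. *)

theory Defs
  imports "Graph_Theory.Graph_Theory" "HOL-Algebra.Algebra"
begin

section \<open>Alphabets with a formal inversion and free groups\<close>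

definition involutive_alphabet :: "'a set \<Rightarrow> ('a \<Rightarrow> 'a) \<Rightarrow> bool" where
  "involutive_alphabet A \<iota> \<longleftrightarrow> (\<forall>a\<in>A. \<iota> a \<in> A \<and> \<iota> a \<noteq> a \<and> \<iota> (\<iota> a) = a)"

definition reduced_word :: "('a \<Rightarrow> 'a) \<Rightarrow> 'a list \<Rightarrow> bool" where
  "reduced_word \<iota> w \<longleftrightarrow> successively (\<lambda>a b. b \<noteq> \<iota> a) w"

fun cancel_cons :: "('a \<Rightarrow> 'a) \<Rightarrow> 'a \<Rightarrow> 'a list \<Rightarrow> 'a list" where
  "cancel_cons \<iota> a [] = [a]"
| "cancel_cons \<iota> a (b # w) = (if b = \<iota> a then w else a # b # w)"

definition reduce_word :: "('a \<Rightarrow> 'a) \<Rightarrow> 'a list \<Rightarrow> 'a list" where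
  "reduce_word \<iota> w = foldr (cancel_cons \<iota>) w []"

definition free_grp :: "'a set \<Rightarrow> ('a \<Rightarrow> 'a) \<Rightarrow> 'a list monoid" where
  "free_grp A \<iota> = \<lparr>carrier = {w \<in> lists A. reduced_word \<iota> w},
     mult = (\<lambda>u v. reduce_word \<iota> (u @ v)), one = []\<rparr>"


section \<open>Word problems\<close>

text \<open>The letters need not be elements of the group; \<open>\<pi>\<close> maps a letter to its image.\<close>

definition generated_by :: "('g, 'm) monoid_scheme \<Rightarrow> 'a set \<Rightarrow> ('a \<Rightarrow> 'a) \<Rightarrow> ('a \<Rightarrow> 'g) \<Rightarrow> bool" where
  "generated_by G A \<iota> \<pi> \<longleftrightarrow> group G \<and> \<pi> ` A \<subseteq> carrier G \<and>
     (\<forall>a\<in>A. \<pi> (\<iota> a) = inv\<^bsub>G\<^esub> \<pi> a) \<and> generate G (\<pi> ` A) = carrier G"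

definition word_value :: "('g, 'm) monoid_scheme \<Rightarrow> ('a \<Rightarrow> 'g) \<Rightarrow> 'a list \<Rightarrow> 'g" where
  "word_value G \<pi> w = foldr (mult G) (map \<pi> w) \<one>\<^bsub>G\<^esub>"

definition WP :: "('g, 'm) monoid_scheme \<Rightarrow> 'a set \<Rightarrow> ('a \<Rightarrow> 'g) \<Rightarrow> 'a list set" where
  "WP G A \<pi> = {w \<in> lists A. word_value G \<pi> w = \<one>\<^bsub>G\<^esub>}"


section \<open>Context-free languages\<close>

datatype ('n, 't) symbol = Nt 'n | Tm 't

inductive derives :: "('n \<times> ('n, 't) symbol list) set \<Rightarrow> ('n, 't) symbol list \<Rightarrow> ('n, 't) symbol list \<Rightarrow> bool"
  for P where
  "(n, \<alpha>) \<in> P \<Longrightarrow> derives P (u @ [Nt n] @ v) (u @ \<alpha> @ v)"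

definition grammar_language :: "('n \<times> ('n, 't) symbol list) set \<Rightarrow> 'n \<Rightarrow> 't list set" where
  "grammar_language P S = {w. (derives P)\<^sup>*\<^sup>* [Nt S] (map Tm w)}"

text \<open>Only finitely many nonterminals occur in a finite set of productions, so taking them
  from \<open>nat\<close> loses no generality.\<close>

definition context_free :: "'t list set \<Rightarrow> bool" where
  "context_free L \<longleftrightarrow>
     (\<exists>(P :: (nat \<times> (nat, 't) symbol list) set) S. finite P \<and> L = grammar_language P S)"


section \<open>$A$-graphs\<close>

record ('a, 'v, 'e) labelled_graph =
  dgraph :: "('v, 'e) pre_digraph"
  edge_label :: "'e \<Rightarrow> 'a"
  edge_inv :: "'e \<Rightarrow> 'e"

text \<open>The locale \<^locale>\<open>bidirected_digraph\<close> says that \<^const>\<open>edge_inv\<close> is a fixed-point-free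
  involution on the edges exchanging initial and terminal vertices; outside the edge set it is
  normalized to be the identity. Connectedness in \<^theory>\<open>Graph_Theory.Digraph_Component\<close>
  includes that the graph is nonempty.\<close>

definition A_graph :: "'a set \<Rightarrow> ('a \<Rightarrow> 'a) \<Rightarrow> ('a, 'v, 'e) labelled_graph \<Rightarrow> bool" where
  "A_graph A \<iota> \<Gamma> \<longleftrightarrow>
     bidirected_digraph (dgraph \<Gamma>) (edge_inv \<Gamma>) \<and>
     Digraph_Component.connected (dgraph \<Gamma>) \<and>
     (\<forall>e\<in>arcs (dgraph \<Gamma>). edge_label \<Gamma> e \<in> A \<and> edge_label \<Gamma> (edge_inv \<Gamma> e) = \<iota> (edge_label \<Gamma> e)) \<and>
     (\<forall>e\<in>arcs (dgraph \<Gamma>). \<forall>f\<in>arcs (dgraph \<Gamma>).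
        tail (dgraph \<Gamma>) e = tail (dgraph \<Gamma>) f \<and> edge_label \<Gamma> e = edge_label \<Gamma> f \<longrightarrow> e = f)"

definition complete_A_graph :: "'a set \<Rightarrow> ('a \<Rightarrow> 'a) \<Rightarrow> ('a, 'v, 'e) labelled_graph \<Rightarrow> bool" where
  "complete_A_graph A \<iota> \<Gamma> \<longleftrightarrow> A_graph A \<iota> \<Gamma> \<and>
     (\<forall>v\<in>verts (dgraph \<Gamma>). \<forall>a\<in>A. \<exists>e\<in>arcs (dgraph \<Gamma>). tail (dgraph \<Gamma>) e = v \<and> edge_label \<Gamma> e = a)"

definition circuit_language :: "('a, 'v, 'e) labelled_graph \<Rightarrow> 'v \<Rightarrow> 'a list set" where
  "circuit_language \<Gamma> x = {map (edge_label \<Gamma>) p | p. pre_digraph.awalk (dgraph \<Gamma>) x p x}"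

definition context_free_graph :: "('a, 'v, 'e) labelled_graph \<Rightarrow> bool" where
  "context_free_graph \<Gamma> \<longleftrightarrow> (\<exists>x\<in>verts (dgraph \<Gamma>). context_free (circuit_language \<Gamma> x))"


section \<open>Transition groups\<close>

text \<open>The family \<open>\<Gamma> 0, \<dots>, \<Gamma> (k - 1)\<close> stands for the disjoint union of its members. The definition
  is meaningful for complete graphs, for which the set of reduced words below is a normal
  subgroup of the free group; it is also the set of reduced forms of the words in the
  intersection of the circuit languages.\<close>

definition transition_group ::
  "'a set \<Rightarrow> ('a \<Rightarrow> 'a) \<Rightarrow> nat \<Rightarrow> (nat \<Rightarrow> ('a, 'v, 'e) labelled_graph) \<Rightarrow> 'a list set monoid" where
  "transition_group A \<iota> k \<Gamma> = free_grp A \<iota> Mod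
     (carrier (free_grp A \<iota>) \<inter> (\<Inter>i<k. \<Inter>p\<in>verts (dgraph (\<Gamma> i)). circuit_language (\<Gamma> i) p))"

text \<open>A connected $A$-graph over a finite alphabet has countably many vertices and edges. Hence, up
  to isomorphism, all finite alphabets and all $A$-graphs over them occur with letters, vertices
  and edges in \<open>nat\<close>.\<close>

definition CF_TR :: "('g, 'm) monoid_scheme \<Rightarrow> bool" where
  "CF_TR G \<longleftrightarrow> group G \<and>
     (\<exists>(A :: nat set) \<iota> k (\<Gamma> :: nat \<Rightarrow> (nat, nat, nat) labelled_graph).
        finite A \<and> involutive_alphabet A \<iota> \<and>
        (\<forall>i<k. complete_A_graph A \<iota> (\<Gamma> i) \<and> context_free_graph (\<Gamma> i)) \<and>
        G \<cong> transition_group A \<iota> k \<Gamma>)"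

end

theory Submission
  imports Defs
begin

text \<open>Write \<open>N\<close> for the set of words over \<open>A\<close> that represent the identity of \<open>G\<close>. The point is that
  \<open>N\<close> is invariant under conjugation, whereas a circuit language depends on its base vertex.
  Suppose that \<open>N\<close> is the intersection of the languages \<open>L(\<Gamma> i, x i)\<close> and that the word \<open>u\<close> leads
  from \<open>x i\<close> to \<open>p\<close> in \<open>\<Gamma> i\<close>. For \<open>w \<in> N\<close> the word \<open>u w u\<inverse>\<close> is in \<open>N\<close> as well, hence labels a circuit
  at \<open>x i\<close>. As the graph is deterministic, this circuit runs first along \<open>u\<close> to \<open>p\<close> and finally
  back along \<open>u\<inverse>\<close> from \<open>p\<close>, so \<open>w\<close> labels a circuit at \<open>p\<close>. Because \<open>\<Gamma> i\<close> is connected, every vertex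
  is such a \<open>p\<close> (\<open>word_problem_subset_circuit_language\<close>).

  This has two consequences. Taking \<open>w = a a\<inverse>\<close> shows that every vertex has an outgoing edge
  labelled \<open>a\<close>, which is completeness. And the intersection of the circuit languages over all
  vertices of all graphs is again \<open>N\<close>, so the subgroup factored out in the definition of
  the transition group is the kernel of the evaluation homomorphism from the free group onto
  \<open>G\<close>, and the isomorphism is the first isomorphism theorem (\<open>iso_transition_group\<close>).

  Membership in \<open>CF_TR\<close> asks in addition for letters, vertices and edges in \<open>nat\<close>. Words over
  a finite alphabet are countable in number, and in a connected deterministic graph they
  determine the vertices and edges. All data can therefore be renamed injectively into the
  natural numbers; circuit languages are renamed letter by letter, which preserves
  context-freeness, and the result just described applies to the renamed data.\<close>

section \<open>The free group on an involutive alphabet\<close>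

definition formal_inverse :: "('a \<Rightarrow> 'a) \<Rightarrow> 'a list \<Rightarrow> 'a list" where
  "formal_inverse \<iota> w = rev (map \<iota> w)"

lemma formal_inverse_in_lists:
  "involutive_alphabet A \<iota> \<Longrightarrow> w \<in> lists A \<Longrightarrow> formal_inverse \<iota> w \<in> lists A"
  by (auto simp: formal_inverse_def involutive_alphabet_def in_lists_conv_set)

lemma formal_inverse_involutive:
  assumes "involutive_alphabet A \<iota>" and "w \<in> lists A"
  shows "formal_inverse \<iota> (formal_inverse \<iota> w) = w"
  using assms
  by (auto simp: formal_inverse_def rev_map involutive_alphabet_def in_lists_conv_set
      intro!: map_idI)

lemma reduced_word_Nil [simp]: "reduced_word \<iota> []"
  by (simp add: reduced_word_def)

lemma reduced_word_Cons_Cons [simp]: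
  "reduced_word \<iota> (a # b # w) \<longleftrightarrow> b \<noteq> \<iota> a \<and> reduced_word \<iota> (b # w)"
  by (simp add: reduced_word_def)

lemma reduced_word_ConsD: "reduced_word \<iota> (a # w) \<Longrightarrow> reduced_word \<iota> w"
  by (cases w) auto

lemma cancel_cons_in_free_grp:
  assumes "a \<in> A" and "w \<in> carrier (free_grp A \<iota>)"
  shows "cancel_cons \<iota> a w \<in> carrier (free_grp A \<iota>)"
proof (cases w)
  case Nil
  then show ?thesis using assms by (simp add: free_grp_def reduced_word_def)
next
  case (Cons b v)
  then show ?thesis using assms by (auto simp: free_grp_def dest: reduced_word_ConsD)
qed

lemma foldr_cancel_cons_in_free_grp:
  assumes "u \<in> lists A" and "w \<in> carrier (free_grp A \<iota>)"
  shows "foldr (cancel_cons \<iota>) u w \<in> carrier (free_grp A \<iota>)"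
  using assms by (induction u) (auto intro: cancel_cons_in_free_grp)

lemma reduce_word_in_free_grp:
  "w \<in> lists A \<Longrightarrow> reduce_word \<iota> w \<in> carrier (free_grp A \<iota>)"
  unfolding reduce_word_def
  by (rule foldr_cancel_cons_in_free_grp) (auto simp: free_grp_def)

lemma cancel_cons_inverse_letter:
  assumes "involutive_alphabet A \<iota>" and "a \<in> A" and "w \<in> carrier (free_grp A \<iota>)"
  shows "cancel_cons \<iota> (\<iota> a) (cancel_cons \<iota> a w) = w"
proof -
  have a: "\<iota> (\<iota> a) = a"
    using assms(1,2) by (simp add: involutive_alphabet_def)
  show ?thesis
  proof (cases w)
    case Nil
    then show ?thesis using a by simp
  next
    case (Cons b v)
    show ?thesis
    proof (cases "b = \<iota> a")
      case True
      \<comment> \<open>The letter \<open>b\<close> is cancelled and then put back; it cannot cancel against the rest,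
        since \<open>w\<close> is reduced.\<close>
      have "reduced_word \<iota> (\<iota> a # v)"
        using assms(3) Cons True by (simp add: free_grp_def)
      then have "cancel_cons \<iota> (\<iota> a) v = \<iota> a # v"
        by (cases v) auto
      then show ?thesis using Cons True by simp
    next
      case False
      then show ?thesis using Cons a by simp
    qed
  qed
qed

lemma foldr_cancel_cons_formal_inverse:
  assumes "involutive_alphabet A \<iota>" and "u \<in> lists A" and "w \<in> carrier (free_grp A \<iota>)"
  shows "foldr (cancel_cons \<iota>) (formal_inverse \<iota> u) (foldr (cancel_cons \<iota>) u w) = w"
  using assms(2)
proof (induction u)
  case Nil
  then show ?case by (simp add: formal_inverse_def)
next
  case (Cons a u)
  then show ?case
    using cancel_cons_inverse_letter[OF assms(1) _ foldr_cancel_cons_in_free_grp[OF _ assms(3)], of a u]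
    by (simp add: formal_inverse_def)
qed

text \<open>Prepending letters with cancellation is an action of \<open>A\<close> on the reduced words, in which
  \<open>a\<close> and \<open>\<iota> a\<close> act by mutually inverse permutations. A word and its reduced form therefore act in
  the same way, and this is what makes the multiplication of reduced words associative.\<close>

lemma foldr_cancel_cons_cancel_cons:
  assumes "involutive_alphabet A \<iota>" and "a \<in> A" and "u \<in> lists A"
    and "w \<in> carrier (free_grp A \<iota>)"
  shows "foldr (cancel_cons \<iota>) (cancel_cons \<iota> a u) w = cancel_cons \<iota> a (foldr (cancel_cons \<iota>) u w)"
proof (cases u)
  case Nil
  then show ?thesis by simp
next
  case (Cons b v)
  show ?thesis
  proof (cases "b = \<iota> a")
    case True
    have a: "\<iota> a \<in> A" "\<iota> (\<iota> a) = a"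
      using assms(1,2) by (auto simp: involutive_alphabet_def)
    have "cancel_cons \<iota> a (cancel_cons \<iota> (\<iota> a) (foldr (cancel_cons \<iota>) v w))
        = foldr (cancel_cons \<iota>) v w"
      using cancel_cons_inverse_letter[OF assms(1) a(1) foldr_cancel_cons_in_free_grp, of v w]
        assms(3,4) Cons a(2) by simp
    then show ?thesis using Cons True by simp
  next
    case False
    then show ?thesis using Cons by simp
  qed
qed

lemma foldr_cancel_cons_reduce_word:
  assumes "involutive_alphabet A \<iota>" and "u \<in> lists A" and "w \<in> carrier (free_grp A \<iota>)"
  shows "foldr (cancel_cons \<iota>) (reduce_word \<iota> u) w = foldr (cancel_cons \<iota>) u w"
  using assms(2)
proof (induction u)
  case Nil
  then show ?case by (simp add: reduce_word_def)
next
  case (Cons a u)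
  have "reduce_word \<iota> u \<in> lists A"
    using reduce_word_in_free_grp[of u A \<iota>] Cons by (simp add: free_grp_def)
  then show ?case
    using foldr_cancel_cons_cancel_cons[OF assms(1) _ _ assms(3)] Cons
    by (simp add: reduce_word_def)
qed

lemma reduce_word_append:
  "reduce_word \<iota> (u @ v) = foldr (cancel_cons \<iota>) u (reduce_word \<iota> v)"
  by (simp add: reduce_word_def)

lemma reduce_word_reduced: "reduced_word \<iota> w \<Longrightarrow> reduce_word \<iota> w = w"
proof (induction w)
  case Nil
  then show ?case by (simp add: reduce_word_def)
next
  case (Cons a w)
  then have "reduce_word \<iota> (a # w) = cancel_cons \<iota> a w"
    by (simp add: reduce_word_def reduced_word_ConsD)
  also have "\<dots> = a # w"
    using Cons.prems by (cases w) auto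
  finally show ?case .
qed

lemma group_free_grp:
  assumes inv: "involutive_alphabet A \<iota>"
  shows "group (free_grp A \<iota>)"
proof (rule groupI)
  let ?F = "free_grp A \<iota>"
  have words: "w \<in> lists A" if "w \<in> carrier ?F" for w
    using that by (simp add: free_grp_def)
  have mult: "u \<otimes>\<^bsub>?F\<^esub> v = foldr (cancel_cons \<iota>) u v" if "v \<in> carrier ?F" for u v
    using that by (simp add: free_grp_def reduce_word_append reduce_word_reduced)
  have reduce: "reduce_word \<iota> u = u" if "u \<in> carrier ?F" for u
    using that by (simp add: free_grp_def reduce_word_reduced)
  show closed: "u \<otimes>\<^bsub>?F\<^esub> v \<in> carrier ?F" if "u \<in> carrier ?F" "v \<in> carrier ?F" for u v
    using that by (simp add: mult words foldr_cancel_cons_in_free_grp)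
  show one: "\<one>\<^bsub>?F\<^esub> \<in> carrier ?F"
    by (simp add: free_grp_def)
  show "u \<otimes>\<^bsub>?F\<^esub> v \<otimes>\<^bsub>?F\<^esub> w = u \<otimes>\<^bsub>?F\<^esub> (v \<otimes>\<^bsub>?F\<^esub> w)"
    if u: "u \<in> carrier ?F" and v: "v \<in> carrier ?F" and w: "w \<in> carrier ?F" for u v w
  proof -
    have "u \<otimes>\<^bsub>?F\<^esub> v = reduce_word \<iota> (u @ v)"
      by (simp add: free_grp_def)
    then have "u \<otimes>\<^bsub>?F\<^esub> v \<otimes>\<^bsub>?F\<^esub> w = foldr (cancel_cons \<iota>) (u @ v) w"
      using foldr_cancel_cons_reduce_word[OF inv _ w, of "u @ v"] u v w
      by (simp add: mult words)
    also have "\<dots> = u \<otimes>\<^bsub>?F\<^esub> (v \<otimes>\<^bsub>?F\<^esub> w)"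
      using closed[OF v w] by (simp add: mult v w)
    finally show ?thesis .
  qed
  show "\<one>\<^bsub>?F\<^esub> \<otimes>\<^bsub>?F\<^esub> w = w" if "w \<in> carrier ?F" for w
    using that by (simp add: mult) (simp add: free_grp_def)
  show "\<exists>v\<in>carrier ?F. v \<otimes>\<^bsub>?F\<^esub> w = \<one>\<^bsub>?F\<^esub>" if w: "w \<in> carrier ?F" for w
  proof
    let ?v = "formal_inverse \<iota> w"
    have v: "?v \<in> lists A"
      using words[OF w] by (rule formal_inverse_in_lists[OF inv])
    show "reduce_word \<iota> ?v \<in> carrier ?F"
      using v by (rule reduce_word_in_free_grp)
    have "foldr (cancel_cons \<iota>) w [] = w"
      using reduce[OF w] by (simp add: reduce_word_def)
    then have "foldr (cancel_cons \<iota>) ?v w = []"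
      using foldr_cancel_cons_formal_inverse[OF inv words[OF w], of "[]"] one
      by (simp add: free_grp_def)
    then show "reduce_word \<iota> ?v \<otimes>\<^bsub>?F\<^esub> w = \<one>\<^bsub>?F\<^esub>"
      using foldr_cancel_cons_reduce_word[OF inv v w] by (simp add: mult[OF w]) (simp add: free_grp_def)
  qed
qed


section \<open>Evaluating words in a group\<close>

lemma generated_byD:
  assumes "generated_by G A \<iota> \<pi>"
  shows "group G" and "a \<in> A \<Longrightarrow> \<pi> a \<in> carrier G" and "a \<in> A \<Longrightarrow> \<pi> (\<iota> a) = inv\<^bsub>G\<^esub> \<pi> a"
    and "generate G (\<pi> ` A) = carrier G"
  using assms by (auto simp: generated_by_def)

lemma word_value_simps [simp]:
  "word_value G \<pi> [] = \<one>\<^bsub>G\<^esub>"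
  "word_value G \<pi> (a # w) = \<pi> a \<otimes>\<^bsub>G\<^esub> word_value G \<pi> w"
  by (simp_all add: word_value_def)

lemma word_value_closed:
  assumes "generated_by G A \<iota> \<pi>" and "w \<in> lists A"
  shows "word_value G \<pi> w \<in> carrier G"
proof -
  interpret group G using assms(1) by (rule generated_byD)
  show ?thesis
    using assms(2) by (induction w) (auto simp: generated_byD[OF assms(1)])
qed

lemma word_value_append:
  assumes "generated_by G A \<iota> \<pi>" and "u \<in> lists A" and "v \<in> lists A"
  shows "word_value G \<pi> (u @ v) = word_value G \<pi> u \<otimes>\<^bsub>G\<^esub> word_value G \<pi> v"
proof -
  interpret group G using assms(1) by (rule generated_byD)
  show ?thesis
    using assms(2)
    by (induction u)
      (auto simp: generated_byD[OF assms(1)] word_value_closed[OF assms(1)] assms(3) m_assoc)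
qed

lemma word_value_formal_inverse:
  assumes "involutive_alphabet A \<iota>" and "generated_by G A \<iota> \<pi>" and "w \<in> lists A"
  shows "word_value G \<pi> (formal_inverse \<iota> w) = inv\<^bsub>G\<^esub> word_value G \<pi> w"
proof -
  interpret group G using assms(2) by (rule generated_byD)
  note gen = generated_byD[OF assms(2)]
  show ?thesis
    using assms(3)
  proof (induction w)
    case Nil
    then show ?case by (simp add: formal_inverse_def)
  next
    case (Cons a w)
    have "\<iota> a \<in> A"
      using Cons assms(1) by (simp add: involutive_alphabet_def)
    then have "word_value G \<pi> (formal_inverse \<iota> w @ [\<iota> a])
        = word_value G \<pi> (formal_inverse \<iota> w) \<otimes>\<^bsub>G\<^esub> word_value G \<pi> [\<iota> a]"
      using word_value_append[OF assms(2)] formal_inverse_in_lists[OF assms(1)] Cons by simp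
    then show ?case
      using Cons gen word_value_closed[OF assms(2), of w]
      by (simp add: formal_inverse_def inv_mult_group)
  qed
qed

lemma word_value_cancel_cons:
  assumes "generated_by G A \<iota> \<pi>" and "a \<in> A" and "w \<in> lists A"
  shows "word_value G \<pi> (cancel_cons \<iota> a w) = \<pi> a \<otimes>\<^bsub>G\<^esub> word_value G \<pi> w"
proof -
  interpret group G using assms(1) by (rule generated_byD)
  note gen = generated_byD[OF assms(1)]
  show ?thesis
  proof (cases w)
    case Nil
    then show ?thesis by simp
  next
    case (Cons b v)
    have "\<pi> a \<otimes>\<^bsub>G\<^esub> (inv\<^bsub>G\<^esub> \<pi> a \<otimes>\<^bsub>G\<^esub> word_value G \<pi> v) = word_value G \<pi> v"
      using word_value_closed[OF assms(1), of v] gen assms Cons by (simp add: m_assoc[symmetric])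
    then show ?thesis using Cons gen assms by simp
  qed
qed

lemma word_value_reduce_word:
  assumes "generated_by G A \<iota> \<pi>" and "w \<in> lists A"
  shows "word_value G \<pi> (reduce_word \<iota> w) = word_value G \<pi> w"
  using assms(2)
proof (induction w)
  case Nil
  then show ?case by (simp add: reduce_word_def)
next
  case (Cons a w)
  have "reduce_word \<iota> w \<in> lists A"
    using reduce_word_in_free_grp[of w A \<iota>] Cons by (simp add: free_grp_def)
  then show ?case
    using word_value_cancel_cons[OF assms(1)] Cons by (simp add: reduce_word_def)
qed

lemma group_hom_word_value:
  assumes "involutive_alphabet A \<iota>" and "generated_by G A \<iota> \<pi>"
  shows "group_hom (free_grp A \<iota>) G (word_value G \<pi>)"
proof (intro group_hom.intro group_hom_axioms.intro homI)
  show "group (free_grp A \<iota>)" using assms(1) by (rule group_free_grp)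
  show "group G" using assms(2) by (rule generated_byD)
qed (use assms(2) in \<open>auto simp: free_grp_def word_value_reduce_word word_value_append
    intro: word_value_closed\<close>)

lemma word_value_onto:
  assumes inv: "involutive_alphabet A \<iota>" and gen: "generated_by G A \<iota> \<pi>"
  shows "word_value G \<pi> ` carrier (free_grp A \<iota>) = carrier G"
proof
  show "word_value G \<pi> ` carrier (free_grp A \<iota>) \<subseteq> carrier G"
    using word_value_closed[OF gen] by (auto simp: free_grp_def)
  interpret group G using gen by (rule generated_byD)
  have "\<exists>w\<in>lists A. word_value G \<pi> w = g" if "g \<in> generate G (\<pi> ` A)" for g
    using that
  proof (induction rule: generate.induct)
    case one
    show ?case by (rule bexI[of _ "[]"]) auto
  next
    case (incl g)
    then obtain a where "a \<in> A" "g = \<pi> a" by auto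
    then show ?case
      using generated_byD[OF gen] by (intro bexI[of _ "[a]"]) auto
  next
    case (inv g)
    then obtain a where a: "a \<in> A" "g = \<pi> a" by auto
    moreover have "\<iota> a \<in> A" using a assms(1) by (simp add: involutive_alphabet_def)
    ultimately show ?case
      using generated_byD[OF gen] by (intro bexI[of _ "[\<iota> a]"]) auto
  next
    case (eng g h)
    then obtain u v where "u \<in> lists A" "v \<in> lists A" "word_value G \<pi> u = g" "word_value G \<pi> v = h"
      by auto
    then show ?case
      using word_value_append[OF gen] by (intro bexI[of _ "u @ v"]) auto
  qed
  then have "\<exists>w\<in>carrier (free_grp A \<iota>). word_value G \<pi> w = g" if "g \<in> carrier G" for g
    using that generated_byD(4)[OF gen] word_value_reduce_word[OF gen] reduce_word_in_free_grp
    by metis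
  then show "carrier G \<subseteq> word_value G \<pi> ` carrier (free_grp A \<iota>)"
    by force
qed

lemma conjugate_in_WP:
  assumes "involutive_alphabet A \<iota>" and "generated_by G A \<iota> \<pi>"
    and "u \<in> lists A" and "w \<in> WP G A \<pi>"
  shows "u @ w @ formal_inverse \<iota> u \<in> WP G A \<pi>"
proof -
  interpret group G using assms(2) by (rule generated_byD)
  have w: "w \<in> lists A" "word_value G \<pi> w = \<one>\<^bsub>G\<^esub>"
    using assms(4) by (auto simp: WP_def)
  have u': "formal_inverse \<iota> u \<in> lists A"
    using assms(1,3) by (rule formal_inverse_in_lists)
  have "word_value G \<pi> (u @ w @ formal_inverse \<iota> u) = \<one>\<^bsub>G\<^esub>"
    using w u' assms(3) word_value_closed[OF assms(2)]
    by (simp add: word_value_append[OF assms(2)] word_value_formal_inverse[OF assms(1,2)])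
  then show ?thesis
    using w u' assms(3) by (simp add: WP_def)
qed

section \<open>Reading words in a labelled graph\<close>

definition reads :: "('a, 'v, 'e) labelled_graph \<Rightarrow> 'v \<Rightarrow> 'a list \<Rightarrow> 'v \<Rightarrow> bool" where
  "reads \<Gamma> u w v \<longleftrightarrow> (\<exists>p. pre_digraph.awalk (dgraph \<Gamma>) u p v \<and> map (edge_label \<Gamma>) p = w)"

lemma circuit_language_reads: "circuit_language \<Gamma> u = {w. reads \<Gamma> u w u}"
  by (auto simp: circuit_language_def reads_def)

lemma A_graphD:
  assumes "A_graph A \<iota> \<Gamma>"
  shows "bidirected_digraph (dgraph \<Gamma>) (edge_inv \<Gamma>)"
    and "wf_digraph (dgraph \<Gamma>)"
    and "connected (dgraph \<Gamma>)"
    and "e \<in> arcs (dgraph \<Gamma>) \<Longrightarrow> edge_label \<Gamma> e \<in> A"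
    and "e \<in> arcs (dgraph \<Gamma>) \<Longrightarrow> edge_label \<Gamma> (edge_inv \<Gamma> e) = \<iota> (edge_label \<Gamma> e)"
    and "e \<in> arcs (dgraph \<Gamma>) \<Longrightarrow> f \<in> arcs (dgraph \<Gamma>) \<Longrightarrow> tail (dgraph \<Gamma>) e = tail (dgraph \<Gamma>) f \<Longrightarrow>
      edge_label \<Gamma> e = edge_label \<Gamma> f \<Longrightarrow> e = f"
  using assms by (auto simp: A_graph_def bidirected_digraph_def)

lemma reads_Nil: "wf_digraph (dgraph \<Gamma>) \<Longrightarrow> reads \<Gamma> u [] v \<longleftrightarrow> u = v \<and> u \<in> verts (dgraph \<Gamma>)"
  by (auto simp: reads_def wf_digraph.awalk_Nil_iff)

lemma reads_Cons:
  assumes "wf_digraph (dgraph \<Gamma>)"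
  shows "reads \<Gamma> u (a # w) v \<longleftrightarrow>
    (\<exists>e\<in>arcs (dgraph \<Gamma>). tail (dgraph \<Gamma>) e = u \<and> edge_label \<Gamma> e = a \<and> reads \<Gamma> (head (dgraph \<Gamma>) e) w v)"
proof
  assume "reads \<Gamma> u (a # w) v"
  then obtain p where "pre_digraph.awalk (dgraph \<Gamma>) u p v" "map (edge_label \<Gamma>) p = a # w"
    by (auto simp: reads_def)
  then show "\<exists>e\<in>arcs (dgraph \<Gamma>). tail (dgraph \<Gamma>) e = u \<and> edge_label \<Gamma> e = a \<and> reads \<Gamma> (head (dgraph \<Gamma>) e) w v"
    by (cases p) (auto simp: reads_def wf_digraph.awalk_Cons_iff[OF assms])
next
  assume "\<exists>e\<in>arcs (dgraph \<Gamma>). tail (dgraph \<Gamma>) e = u \<and> edge_label \<Gamma> e = a \<and> reads \<Gamma> (head (dgraph \<Gamma>) e) w v"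
  then obtain e p where e: "e \<in> arcs (dgraph \<Gamma>)" "tail (dgraph \<Gamma>) e = u" "edge_label \<Gamma> e = a"
    and p: "pre_digraph.awalk (dgraph \<Gamma>) (head (dgraph \<Gamma>) e) p v" "map (edge_label \<Gamma>) p = w"
    by (auto simp: reads_def)
  then have "pre_digraph.awalk (dgraph \<Gamma>) u (e # p) v"
    by (simp add: wf_digraph.awalk_Cons_iff[OF assms])
  then show "reads \<Gamma> u (a # w) v"
    using e p unfolding reads_def by (intro exI[of _ "e # p"]) simp
qed

lemma reads_in_verts:
  assumes "wf_digraph (dgraph \<Gamma>)" and "reads \<Gamma> u w v"
  shows "u \<in> verts (dgraph \<Gamma>)" and "v \<in> verts (dgraph \<Gamma>)"
  using assms by (auto simp: reads_def wf_digraph.awalk_hd_in_verts wf_digraph.awalk_last_in_verts)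

lemma reads_append:
  assumes "wf_digraph (dgraph \<Gamma>)"
  shows "reads \<Gamma> u (w @ w') v \<longleftrightarrow> (\<exists>t. reads \<Gamma> u w t \<and> reads \<Gamma> t w' v)"
  by (induction w arbitrary: u)
    (auto simp: reads_Nil[OF assms] reads_Cons[OF assms] dest: reads_in_verts[OF assms])

lemma reads_in_lists:
  assumes "A_graph A \<iota> \<Gamma>" and "reads \<Gamma> u w v"
  shows "w \<in> lists A"
  using assms(2)
  by (induction w arbitrary: u) (auto simp: reads_Cons[OF A_graphD(2)[OF assms(1)]] A_graphD(4)[OF assms(1)])

lemma reads_deterministic:
  assumes "A_graph A \<iota> \<Gamma>" and "reads \<Gamma> u w v" and "reads \<Gamma> u w v'"
  shows "v = v'"
  using assms(2,3)
proof (induction w arbitrary: u)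
  case Nil
  then show ?case by (simp add: reads_Nil[OF A_graphD(2)[OF assms(1)]])
next
  case (Cons a w)
  then show ?case
    by (auto simp: reads_Cons[OF A_graphD(2)[OF assms(1)]] dest: A_graphD(6)[OF assms(1)])
qed

lemma reads_formal_inverse:
  assumes "A_graph A \<iota> \<Gamma>" and "reads \<Gamma> u w v"
  shows "reads \<Gamma> v (formal_inverse \<iota> w) u"
  using assms(2)
proof (induction w arbitrary: u)
  interpret bidirected_digraph "dgraph \<Gamma>" "edge_inv \<Gamma>"
    using assms(1) by (rule A_graphD)
  {
    case Nil
    then show ?case by (auto simp: reads_Nil wf_digraph formal_inverse_def)
  next
    case (Cons a w)
    then obtain e where e: "e \<in> arcs (dgraph \<Gamma>)" "tail (dgraph \<Gamma>) e = u" "edge_label \<Gamma> e = a"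
      and w: "reads \<Gamma> (head (dgraph \<Gamma>) e) w v"
      by (auto simp: reads_Cons wf_digraph)
    have "reads \<Gamma> (head (dgraph \<Gamma>) e) [\<iota> a] u"
      using e A_graphD(5)[OF assms(1)]
      by (auto simp: reads_Cons reads_Nil wf_digraph intro!: bexI[of _ "edge_inv \<Gamma> e"])
    then show ?case
      using Cons.IH[OF w] by (auto simp: formal_inverse_def reads_append wf_digraph)
  }
qed

lemma A_graph_reads_connected:
  assumes "A_graph A \<iota> \<Gamma>" and "u \<in> verts (dgraph \<Gamma>)" and "v \<in> verts (dgraph \<Gamma>)"
  obtains w where "reads \<Gamma> u w v"
proof -
  interpret bidirected_digraph "dgraph \<Gamma>" "edge_inv \<Gamma>"
    using assms(1) by (rule A_graphD)
  have "strongly_connected (dgraph \<Gamma>)"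
    using sym_arcs A_graphD(3)[OF assms(1)] by (rule symmetric_connected_imp_strongly_connected)
  then have "u \<rightarrow>\<^sup>*\<^bsub>dgraph \<Gamma>\<^esub> v"
    using assms(2,3) by auto
  then show ?thesis
    using that by (auto simp: reachable_awalk reads_def)
qed

section \<open>Transition groups and word problems\<close>

lemma word_problem_subset_circuit_language:
  assumes inv: "involutive_alphabet A \<iota>" and gen: "generated_by G A \<iota> \<pi>"
    and \<Gamma>: "A_graph A \<iota> \<Gamma>" and x: "x \<in> verts (dgraph \<Gamma>)"
    and sub: "WP G A \<pi> \<subseteq> circuit_language \<Gamma> x"
    and p: "p \<in> verts (dgraph \<Gamma>)"
  shows "WP G A \<pi> \<subseteq> circuit_language \<Gamma> p"
proof
  fix w assume w: "w \<in> WP G A \<pi>"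
  obtain u where u: "reads \<Gamma> x u p"
    using A_graph_reads_connected[OF \<Gamma> x p] .
  have uA: "u \<in> lists A"
    using \<Gamma> u by (rule reads_in_lists)
  have "reads \<Gamma> x (u @ w @ formal_inverse \<iota> u) x"
    using conjugate_in_WP[OF inv gen uA w] sub by (auto simp: circuit_language_reads)
  then obtain p' q where p': "reads \<Gamma> x u p'" "reads \<Gamma> p' w q" and q: "reads \<Gamma> q (formal_inverse \<iota> u) x"
    by (auto simp: reads_append[OF A_graphD(2)[OF \<Gamma>]])
  \<comment> \<open>Read backwards, the last part of the circuit is a walk from \<open>x\<close> labelled \<open>u\<close>, so
    determinism applies at both ends of \<open>w\<close>.\<close>
  have "reads \<Gamma> x u q"
    using reads_formal_inverse[OF \<Gamma> q] formal_inverse_involutive[OF inv uA] by simp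
  then have "p' = p" "q = p"
    using reads_deterministic[OF \<Gamma>] u p'(1) by blast+
  then show "w \<in> circuit_language \<Gamma> p"
    using p' by (simp add: circuit_language_reads)
qed

lemma complete_if_word_problem_subset:
  assumes inv: "involutive_alphabet A \<iota>" and gen: "generated_by G A \<iota> \<pi>"
    and \<Gamma>: "A_graph A \<iota> \<Gamma>" and x: "x \<in> verts (dgraph \<Gamma>)"
    and sub: "WP G A \<pi> \<subseteq> circuit_language \<Gamma> x"
  shows "complete_A_graph A \<iota> \<Gamma>"
  unfolding complete_A_graph_def
proof (intro conjI ballI)
  show "A_graph A \<iota> \<Gamma>" by (rule \<Gamma>)
  interpret group G using gen by (rule generated_byD)
  fix v a assume v: "v \<in> verts (dgraph \<Gamma>)" and a: "a \<in> A"
  have "[a, \<iota> a] \<in> WP G A \<pi>"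
    using a inv generated_byD[OF gen] by (simp add: WP_def involutive_alphabet_def)
  then have "reads \<Gamma> v [a, \<iota> a] v"
    using word_problem_subset_circuit_language[OF assms v] by (auto simp: circuit_language_reads)
  then show "\<exists>e\<in>arcs (dgraph \<Gamma>). tail (dgraph \<Gamma>) e = v \<and> edge_label \<Gamma> e = a"
    by (auto simp: reads_Cons[OF A_graphD(2)[OF \<Gamma>]])
qed

lemma iso_transition_group:
  assumes inv: "involutive_alphabet A \<iota>" and gen: "generated_by G A \<iota> \<pi>"
    and \<Gamma>: "\<And>i. i < k \<Longrightarrow> A_graph A \<iota> (\<Gamma> i)"
    and x: "\<And>i. i < k \<Longrightarrow> x i \<in> verts (dgraph (\<Gamma> i))"
    and wp: "WP G A \<pi> = lists A \<inter> (\<Inter>i<k. circuit_language (\<Gamma> i) (x i))"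
  shows "G \<cong> transition_group A \<iota> k \<Gamma>"
proof -
  let ?F = "free_grp A \<iota>"
  let ?N = "carrier ?F \<inter> (\<Inter>i<k. \<Inter>p\<in>verts (dgraph (\<Gamma> i)). circuit_language (\<Gamma> i) p)"
  interpret group_hom ?F G "word_value G \<pi>"
    using inv gen by (rule group_hom_word_value)
  have words: "carrier ?F \<subseteq> lists A"
    by (auto simp: free_grp_def)
  have "?N = carrier ?F \<inter> WP G A \<pi>"
  proof
    show "?N \<subseteq> carrier ?F \<inter> WP G A \<pi>"
      using x words by (force simp: wp)
    show "carrier ?F \<inter> WP G A \<pi> \<subseteq> ?N"
      using word_problem_subset_circuit_language[OF inv gen \<Gamma> x] wp by blast
  qed
  also have "\<dots> = kernel ?F G (word_value G \<pi>)"
    using words by (auto simp: kernel_def WP_def)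
  finally have "transition_group A \<iota> k \<Gamma> = ?F Mod kernel ?F G (word_value G \<pi>)"
    by (simp add: transition_group_def)
  moreover have "?F Mod kernel ?F G (word_value G \<pi>) \<cong> G"
    using word_value_onto[OF inv gen] by (rule FactGroup_iso)
  moreover have "group (?F Mod kernel ?F G (word_value G \<pi>))"
    using normal_kernel by (rule normal.factorgroup_is_group)
  ultimately show ?thesis
    using group.iso_sym by metis
qed

section \<open>Renaming letters, vertices and edges\<close>

text \<open>The image of a context-free language under a renaming of letters is context-free even when
  letters are identified: each derivation in the renamed grammar lifts to one in the original
  grammar, because the renaming leaves the nonterminals alone.\<close>

lemma context_free_map:
  assumes "context_free L"
  shows "context_free (map f ` L)"
proof -
  obtain P :: "(nat \<times> (nat, 'a) symbol list) set" and S
    where fin: "finite P" and L: "L = grammar_language P S"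
    using assms by (auto simp: context_free_def)
  let ?h = "map (map_symbol (\<lambda>n. n) f)"
  let ?Q = "map_prod (\<lambda>n. n) ?h ` P"
  have down: "derives ?Q (?h s) (?h t)" if "derives P s t" for s t
    using that
  proof cases
    case (1 n \<alpha> u v)
    then have "(n, ?h \<alpha>) \<in> ?Q" by force
    from derives.intros[OF this, of "?h u" "?h v"] show ?thesis
      using 1 by simp
  qed
  have up: "\<exists>t'. t = ?h t' \<and> derives P s t'" if "derives ?Q (?h s) t" for s t
    using that
  proof cases
    case (1 n \<beta> u v)
    then obtain \<alpha> where \<alpha>: "(n, \<alpha>) \<in> P" "\<beta> = ?h \<alpha>" by auto
    from 1 obtain u' c v' where s: "s = u' @ [c] @ v'" "u = ?h u'" "Nt n = map_symbol (\<lambda>n. n) f c" "v = ?h v'"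
      by (auto simp: map_eq_append_conv map_eq_Cons_conv append_eq_map_conv Cons_eq_map_conv)
    then have "c = Nt n" by (cases c) auto
    then have "derives P s (u' @ \<alpha> @ v')"
      using s derives.intros[OF \<alpha>(1), of u' v'] by simp
    moreover have "t = ?h (u' @ \<alpha> @ v')" using 1 s \<alpha> by simp
    ultimately show ?thesis by blast
  qed
  have downs: "(derives ?Q)\<^sup>*\<^sup>* (?h s) (?h t)" if "(derives P)\<^sup>*\<^sup>* s t" for s t
    using that
  proof induction
    case base
    show ?case ..
  next
    case (step y z)
    show ?case
      using step.IH down[OF step.hyps(2)] by (rule rtranclp.rtrancl_into_rtrancl)
  qed
  have ups: "\<exists>t'. t = ?h t' \<and> (derives P)\<^sup>*\<^sup>* s t'" if "(derives ?Q)\<^sup>*\<^sup>* (?h s) t" for s t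
    using that
  proof induction
    case base
    then show ?case by blast
  next
    case (step y z)
    then obtain y' where "y = ?h y'" "(derives P)\<^sup>*\<^sup>* s y'" by blast
    moreover obtain z' where "z = ?h z'" "derives P y' z'"
      using up step.hyps(2) \<open>y = ?h y'\<close> by blast
    ultimately show ?case
      using rtranclp.rtrancl_into_rtrancl[of "derives P" s y' z'] by blast
  qed
  have terminal: "\<exists>w'. t = map Tm w' \<and> w = map f w'" if "map Tm w = ?h t" for w t
    using that
  proof (induction t arbitrary: w)
    case Nil
    then show ?case by simp
  next
    case (Cons c t)
    then obtain b v where w: "w = b # v" "Tm b = map_symbol (\<lambda>n. n) f c" "map Tm v = ?h t"
      by (auto simp: map_eq_Cons_conv)
    moreover obtain c' where "c = Tm c'" "b = f c'" using w(2) by (cases c) auto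
    moreover obtain v' where "t = map Tm v'" "v = map f v'"
      using Cons.IH[OF w(3)] by blast
    ultimately show ?case by (intro exI[of _ "c' # v'"]) simp
  qed
  have "map f ` L = grammar_language ?Q S"
  proof (intro equalityI subsetI)
    fix w assume "w \<in> map f ` L"
    then obtain w' where "w = map f w'" "(derives P)\<^sup>*\<^sup>* [Nt S] (map Tm w')"
      by (auto simp: L grammar_language_def)
    then show "w \<in> grammar_language ?Q S"
      using downs[of "[Nt S]" "map Tm w'"] by (simp add: grammar_language_def comp_def)
  next
    fix w assume "w \<in> grammar_language ?Q S"
    then have "(derives ?Q)\<^sup>*\<^sup>* (?h [Nt S]) (map Tm w)"
      by (simp add: grammar_language_def)
    then obtain t where t: "map Tm w = ?h t" "(derives P)\<^sup>*\<^sup>* [Nt S] t"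
      using ups by blast
    then obtain w' where "t = map Tm w'" "w = map f w'"
      using terminal by blast
    then show "w \<in> map f ` L"
      using t by (auto simp: L grammar_language_def)
  qed
  then show ?thesis
    using fin unfolding context_free_def by blast
qed

definition vertex_edge_renaming ::
  "('v \<Rightarrow> 'w) \<Rightarrow> ('e \<Rightarrow> 'd) \<Rightarrow> ('v, 'e) pre_digraph \<Rightarrow> ('v, 'e, 'w, 'd) digraph_isomorphism" where
  "vertex_edge_renaming g h D =
     \<lparr>iso_verts = g, iso_arcs = h,
      iso_head = g \<circ> head D \<circ> inv_into (arcs D) h,
      iso_tail = g \<circ> tail D \<circ> inv_into (arcs D) h\<rparr>"

text \<open>The locale \<^locale>\<open>bidirected_digraph\<close> takes the edges to be the points that the edge
  inversion moves; hence its extension by the identity outside the renamed edges.\<close>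

definition rename_graph ::
  "('a \<Rightarrow> 'b) \<Rightarrow> ('v \<Rightarrow> 'w) \<Rightarrow> ('e \<Rightarrow> 'd) \<Rightarrow> ('a, 'v, 'e) labelled_graph \<Rightarrow> ('b, 'w, 'd) labelled_graph"
  where
  "rename_graph f g h \<Gamma> =
     \<lparr>dgraph = app_iso (vertex_edge_renaming g h (dgraph \<Gamma>)) (dgraph \<Gamma>),
      edge_label = f \<circ> edge_label \<Gamma> \<circ> inv_into (arcs (dgraph \<Gamma>)) h,
      edge_inv = (\<lambda>e. if e \<in> h ` arcs (dgraph \<Gamma>)
                      then h (edge_inv \<Gamma> (inv_into (arcs (dgraph \<Gamma>)) h e)) else e)\<rparr>"

lemma rename_graph_simps:
  assumes "inj_on h (arcs (dgraph \<Gamma>))"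
  shows "verts (dgraph (rename_graph f g h \<Gamma>)) = g ` verts (dgraph \<Gamma>)"
    and "arcs (dgraph (rename_graph f g h \<Gamma>)) = h ` arcs (dgraph \<Gamma>)"
    and "e \<in> arcs (dgraph \<Gamma>) \<Longrightarrow>
      tail (dgraph (rename_graph f g h \<Gamma>)) (h e) = g (tail (dgraph \<Gamma>) e)"
    and "e \<in> arcs (dgraph \<Gamma>) \<Longrightarrow>
      head (dgraph (rename_graph f g h \<Gamma>)) (h e) = g (head (dgraph \<Gamma>) e)"
    and "e \<in> arcs (dgraph \<Gamma>) \<Longrightarrow> edge_label (rename_graph f g h \<Gamma>) (h e) = f (edge_label \<Gamma> e)"
    and "e \<in> arcs (dgraph \<Gamma>) \<Longrightarrow> edge_inv (rename_graph f g h \<Gamma>) (h e) = h (edge_inv \<Gamma> e)"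
    and "d \<notin> h ` arcs (dgraph \<Gamma>) \<Longrightarrow> edge_inv (rename_graph f g h \<Gamma>) d = d"
  using assms by (auto simp: rename_graph_def vertex_edge_renaming_def)

definition rename_involution :: "'a set \<Rightarrow> ('a \<Rightarrow> 'b) \<Rightarrow> ('a \<Rightarrow> 'a) \<Rightarrow> 'b \<Rightarrow> 'b" where
  "rename_involution A f \<iota> = f \<circ> \<iota> \<circ> inv_into A f"

lemma rename_involution_apply:
  "inj_on f A \<Longrightarrow> a \<in> A \<Longrightarrow> rename_involution A f \<iota> (f a) = f (\<iota> a)"
  by (simp add: rename_involution_def)

lemma involutive_alphabet_rename:
  assumes "involutive_alphabet A \<iota>" and "inj_on f A"
  shows "involutive_alphabet (f ` A) (rename_involution A f \<iota>)"
  using assms by (auto simp: involutive_alphabet_def rename_involution_apply inj_on_eq_iff)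

lemma wf_digraph_rename_graph:
  assumes "wf_digraph (dgraph \<Gamma>)" and "inj_on h (arcs (dgraph \<Gamma>))"
  shows "wf_digraph (dgraph (rename_graph f g h \<Gamma>))"
  using assms by unfold_locales (auto simp: rename_graph_simps wf_digraph.wellformed)

lemma A_graph_rename_graph:
  assumes \<Gamma>: "A_graph A \<iota> \<Gamma>"
    and f: "inj_on f A" and g: "inj_on g (verts (dgraph \<Gamma>))" and h: "inj_on h (arcs (dgraph \<Gamma>))"
  shows "A_graph (f ` A) (rename_involution A f \<iota>) (rename_graph f g h \<Gamma>)"
proof -
  interpret bidirected_digraph "dgraph \<Gamma>" "edge_inv \<Gamma>"
    using \<Gamma> by (rule A_graphD)
  note simps = rename_graph_simps[OF h]
  interpret R: wf_digraph "dgraph (rename_graph f g h \<Gamma>)"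
    using wf_digraph h by (rule wf_digraph_rename_graph)
  have "bidirected_digraph (dgraph (rename_graph f g h \<Gamma>)) (edge_inv (rename_graph f g h \<Gamma>))"
    using h by (intro R.bidirected_digraphI) (auto simp: simps inj_on_eq_iff arev_neq)
  moreover have "connected (dgraph (rename_graph f g h \<Gamma>))"
  proof -
    have "digraph_isomorphism (vertex_edge_renaming g h (dgraph \<Gamma>))"
      using g h wf_digraph by (simp add: digraph_isomorphism_def vertex_edge_renaming_def)
    with A_graphD(3)[OF \<Gamma>] show ?thesis
      unfolding rename_graph_def by (simp add: connectedI_app_iso)
  qed
  moreover have "e = e'" if "e \<in> arcs (dgraph \<Gamma>)" "e' \<in> arcs (dgraph \<Gamma>)"
    "g (tail (dgraph \<Gamma>) e) = g (tail (dgraph \<Gamma>) e')" "f (edge_label \<Gamma> e) = f (edge_label \<Gamma> e')" for e e'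
  proof -
    have "tail (dgraph \<Gamma>) e = tail (dgraph \<Gamma>) e'" "edge_label \<Gamma> e = edge_label \<Gamma> e'"
      using that f g A_graphD(4)[OF \<Gamma>] by (auto simp: inj_on_eq_iff)
    then show ?thesis using that A_graphD(6)[OF \<Gamma>] by blast
  qed
  ultimately show ?thesis
    unfolding A_graph_def using f
    by (auto simp: simps rename_involution_apply A_graphD(4,5)[OF \<Gamma>])
qed

lemma reads_rename_graph:
  assumes wf: "wf_digraph (dgraph \<Gamma>)"
    and g: "inj_on g (verts (dgraph \<Gamma>))" and h: "inj_on h (arcs (dgraph \<Gamma>))"
    and "u \<in> verts (dgraph \<Gamma>)" and v: "v \<in> verts (dgraph \<Gamma>)"
  shows "reads (rename_graph f g h \<Gamma>) (g u) w (g v) \<longleftrightarrow> (\<exists>w'. w = map f w' \<and> reads \<Gamma> u w' v)"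
  using \<open>u \<in> verts (dgraph \<Gamma>)\<close>
proof (induction w arbitrary: u)
  case Nil
  then show ?case
    using g v by (auto simp: reads_Nil wf wf_digraph_rename_graph[OF wf h] rename_graph_simps[OF h] inj_on_eq_iff)
next
  case (Cons b w)
  have "reads (rename_graph f g h \<Gamma>) (g u) (b # w) (g v) \<longleftrightarrow>
      (\<exists>e\<in>arcs (dgraph \<Gamma>). g (tail (dgraph \<Gamma>) e) = g u \<and> f (edge_label \<Gamma> e) = b \<and>
        reads (rename_graph f g h \<Gamma>) (g (head (dgraph \<Gamma>) e)) w (g v))"
    by (auto simp: reads_Cons[OF wf_digraph_rename_graph[OF wf h]] rename_graph_simps[OF h])
  also have "\<dots> \<longleftrightarrow> (\<exists>e\<in>arcs (dgraph \<Gamma>). tail (dgraph \<Gamma>) e = u \<and> f (edge_label \<Gamma> e) = b \<and>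
        (\<exists>w'. w = map f w' \<and> reads \<Gamma> (head (dgraph \<Gamma>) e) w' v))"
    using Cons g by (auto simp: inj_on_eq_iff wf_digraph.wellformed[OF wf])
  also have "\<dots> \<longleftrightarrow> (\<exists>w'. b # w = map f w' \<and> reads \<Gamma> u w' v)" (is "?L \<longleftrightarrow> ?R")
  proof
    assume ?L
    then obtain e w' where e: "e \<in> arcs (dgraph \<Gamma>)" "tail (dgraph \<Gamma>) e = u" "f (edge_label \<Gamma> e) = b"
      and w': "w = map f w'" "reads \<Gamma> (head (dgraph \<Gamma>) e) w' v"
      by blast
    then have "reads \<Gamma> u (edge_label \<Gamma> e # w') v"
      using reads_Cons[OF wf] by blast
    then show ?R
      using e(3) w'(1) by (intro exI[of _ "edge_label \<Gamma> e # w'"]) simp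
  next
    assume ?R
    then obtain a w' where "b = f a" "w = map f w'" "reads \<Gamma> u (a # w') v"
      by (auto simp: Cons_eq_map_conv)
    then show ?L
      by (auto simp: reads_Cons[OF wf])
  qed
  finally show ?case .
qed

lemma circuit_language_rename_graph:
  assumes "wf_digraph (dgraph \<Gamma>)"
    and "inj_on g (verts (dgraph \<Gamma>))" and "inj_on h (arcs (dgraph \<Gamma>))"
    and "u \<in> verts (dgraph \<Gamma>)"
  shows "circuit_language (rename_graph f g h \<Gamma>) (g u) = map f ` circuit_language \<Gamma> u"
  using reads_rename_graph[OF assms assms(4)] by (auto simp: circuit_language_reads)

lemma word_value_rename:
  assumes "inj_on f A" and "w \<in> lists A"
  shows "word_value G (\<pi> \<circ> inv_into A f) (map f w) = word_value G \<pi> w"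
  using assms(2) by (induction w) (auto simp: assms(1))

lemma generated_by_rename:
  assumes "involutive_alphabet A \<iota>" and "generated_by G A \<iota> \<pi>" and "inj_on f A"
  shows "generated_by G (f ` A) (rename_involution A f \<iota>) (\<pi> \<circ> inv_into A f)"
proof -
  have "(\<pi> \<circ> inv_into A f) ` f ` A = \<pi> ` A"
    using assms(3) by (force simp: image_image)
  then show ?thesis
    using assms by (auto simp: generated_by_def rename_involution_apply involutive_alphabet_def)
qed

lemma WP_rename:
  assumes "inj_on f A"
  shows "WP G (f ` A) (\<pi> \<circ> inv_into A f) = map f ` WP G A \<pi>"
proof (intro equalityI subsetI)
  fix w assume "w \<in> WP G (f ` A) (\<pi> \<circ> inv_into A f)"
  then obtain w' where "w' \<in> lists A" "w = map f w'"
    and "word_value G (\<pi> \<circ> inv_into A f) (map f w') = \<one>\<^bsub>G\<^esub>"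
    by (auto simp: WP_def lists_image)
  then show "w \<in> map f ` WP G A \<pi>"
    by (simp add: WP_def word_value_rename[OF assms])
next
  fix w assume "w \<in> map f ` WP G A \<pi>"
  then obtain w' where "w' \<in> lists A" "w = map f w'" "word_value G \<pi> w' = \<one>\<^bsub>G\<^esub>"
    by (auto simp: WP_def)
  then show "w \<in> WP G (f ` A) (\<pi> \<circ> inv_into A f)"
    by (simp add: WP_def word_value_rename[OF assms] lists_image)
qed

text \<open>Intersections of languages commute with a renaming only as long as all letters are in the
  set on which the renaming is injective. For \<open>k = 0\<close> the intersection over \<open>i < k\<close> is the set of
  all words, and the factor \<open>lists A\<close> cuts it down to the words over the alphabet.\<close>

lemma map_image_INT:
  assumes "inj_on f A" and "\<And>i. i < k \<Longrightarrow> L i \<subseteq> lists A"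
  shows "map f ` (lists A \<inter> (\<Inter>i<k. L i)) = lists (f ` A) \<inter> (\<Inter>i<(k::nat). map f ` L i)"
proof -
  have inj: "inj_on (map f) (lists A)"
    using assms(1) by (rule inj_on_mapI[OF inj_on_subset]) auto
  show ?thesis
  proof (intro equalityI subsetI)
    fix w assume "w \<in> lists (f ` A) \<inter> (\<Inter>i<k. map f ` L i)"
    then obtain w' where w': "w' \<in> lists A" "w = map f w'" "\<forall>i<k. map f w' \<in> map f ` L i"
      by (auto simp: lists_image)
    then have "w' \<in> L i" if "i < k" for i
      using inj_onD[OF inj] assms(2) that by blast
    then show "w \<in> map f ` (lists A \<inter> (\<Inter>i<k. L i))"
      using w' by auto
  qed (auto simp: lists_image)
qed

section \<open>Countability of graphs over a finite alphabet\<close>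

text \<open>A vertex is determined by a word that leads to it from a fixed vertex, and an edge by its
  initial vertex and its label.\<close>

lemma countable_A_graph:
  assumes fin: "finite A" and \<Gamma>: "A_graph A \<iota> \<Gamma>"
  shows "countable (verts (dgraph \<Gamma>))" and "countable (arcs (dgraph \<Gamma>))"
proof -
  show verts: "countable (verts (dgraph \<Gamma>))"
  proof (cases "verts (dgraph \<Gamma>) = {}")
    case False
    then obtain x where x: "x \<in> verts (dgraph \<Gamma>)" by blast
    have "\<exists>w\<in>lists A. v = (THE v. reads \<Gamma> x w v)" if v: "v \<in> verts (dgraph \<Gamma>)" for v
    proof -
      obtain w where w: "reads \<Gamma> x w v"
        using A_graph_reads_connected[OF \<Gamma> x v] .
      then have "(THE v. reads \<Gamma> x w v) = v"
        using reads_deterministic[OF \<Gamma>] by blast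
      then show ?thesis
        using reads_in_lists[OF \<Gamma> w] by force
    qed
    then have "verts (dgraph \<Gamma>) \<subseteq> (\<lambda>w. THE v. reads \<Gamma> x w v) ` lists A"
      by blast
    then show ?thesis
      using fin by (meson countable_finite countable_image countable_lists countable_subset)
  qed simp
  have "inj_on (\<lambda>e. (tail (dgraph \<Gamma>) e, edge_label \<Gamma> e)) (arcs (dgraph \<Gamma>))"
    using A_graphD(6)[OF \<Gamma>] by (auto simp: inj_on_def)
  moreover have "(\<lambda>e. (tail (dgraph \<Gamma>) e, edge_label \<Gamma> e)) ` arcs (dgraph \<Gamma>) \<subseteq> verts (dgraph \<Gamma>) \<times> A"
    using A_graphD(4)[OF \<Gamma>] wf_digraph.tail_in_verts[OF A_graphD(2)[OF \<Gamma>]] by auto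
  moreover have "countable (verts (dgraph \<Gamma>) \<times> A)"
    using verts fin by (simp add: countable_finite)
  ultimately show "countable (arcs (dgraph \<Gamma>))"
    by (meson countable_image_inj_on countable_subset)
qed

section \<open>Groups whose word problem is an intersection of circuit languages\<close>

lemma CF_TR_if_word_problem_INT:
  fixes A :: "'a set" and k :: nat and \<Gamma> :: "nat \<Rightarrow> ('a, 'v, 'e) labelled_graph"
  assumes fin: "finite A" and inv: "involutive_alphabet A \<iota>"
    and gen: "generated_by G A \<iota> \<pi>"
    and \<Gamma>: "\<And>i. i < k \<Longrightarrow> A_graph A \<iota> (\<Gamma> i)"
    and x: "\<And>i. i < k \<Longrightarrow> x i \<in> verts (dgraph (\<Gamma> i))"
    and cf: "\<And>i. i < k \<Longrightarrow> context_free (circuit_language (\<Gamma> i) (x i))"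
    and wp: "WP G A \<pi> = lists A \<inter> (\<Inter>i<k. circuit_language (\<Gamma> i) (x i))"
  shows "CF_TR G"
proof -
  obtain f :: "'a \<Rightarrow> nat" where f: "inj_on f A"
    using fin finite_imp_inj_to_nat_seg by blast
  define g where "g i = to_nat_on (verts (dgraph (\<Gamma> i)))" for i
  define h where "h i = to_nat_on (arcs (dgraph (\<Gamma> i)))" for i
  have g: "inj_on (g i) (verts (dgraph (\<Gamma> i)))" and h: "inj_on (h i) (arcs (dgraph (\<Gamma> i)))"
    if "i < k" for i
    using countable_A_graph[OF fin \<Gamma>[OF that]] by (auto simp: g_def h_def)
  define B where "B = f ` A"
  define \<kappa> where "\<kappa> = rename_involution A f \<iota>"
  define \<rho> where "\<rho> = \<pi> \<circ> inv_into A f"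
  define \<Delta> where "\<Delta> i = rename_graph f (g i) (h i) (\<Gamma> i)" for i
  define y where "y i = g i (x i)" for i
  have inv': "involutive_alphabet B \<kappa>"
    unfolding B_def \<kappa>_def using inv f by (rule involutive_alphabet_rename)
  have gen': "generated_by G B \<kappa> \<rho>"
    unfolding B_def \<kappa>_def \<rho>_def using inv gen f by (rule generated_by_rename)
  have \<Delta>: "A_graph B \<kappa> (\<Delta> i)" if "i < k" for i
    unfolding B_def \<kappa>_def \<Delta>_def using \<Gamma>[OF that] f g[OF that] h[OF that]
    by (rule A_graph_rename_graph)
  have y: "y i \<in> verts (dgraph (\<Delta> i))" if "i < k" for i
    using x[OF that] by (simp add: y_def \<Delta>_def rename_graph_simps[OF h[OF that]])
  have circ: "circuit_language (\<Delta> i) (y i) = map f ` circuit_language (\<Gamma> i) (x i)" if "i < k" for i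
    unfolding \<Delta>_def y_def using A_graphD(2)[OF \<Gamma>[OF that]] g[OF that] h[OF that] x[OF that]
    by (rule circuit_language_rename_graph)
  have "circuit_language (\<Gamma> i) (x i) \<subseteq> lists A" if "i < k" for i
    using reads_in_lists[OF \<Gamma>[OF that]] by (auto simp: circuit_language_reads)
  then have "WP G B \<rho> = lists B \<inter> (\<Inter>i<k. map f ` circuit_language (\<Gamma> i) (x i))"
    unfolding B_def \<rho>_def WP_rename[OF f] wp by (rule map_image_INT[OF f])
  then have wp': "WP G B \<rho> = lists B \<inter> (\<Inter>i<k. circuit_language (\<Delta> i) (y i))"
    by (simp add: circ)
  have "complete_A_graph B \<kappa> (\<Delta> i) \<and> context_free_graph (\<Delta> i)" if "i < k" for i
  proof
    show "complete_A_graph B \<kappa> (\<Delta> i)"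
      using inv' gen' \<Delta>[OF that] y[OF that]
      by (rule complete_if_word_problem_subset) (use wp' that in blast)
    show "context_free_graph (\<Delta> i)"
      unfolding context_free_graph_def
    proof
      show "y i \<in> verts (dgraph (\<Delta> i))" using y[OF that] .
      show "context_free (circuit_language (\<Delta> i) (y i))"
        unfolding circ[OF that] by (rule context_free_map[OF cf[OF that]])
    qed
  qed
  moreover have "G \<cong> transition_group B \<kappa> k \<Delta>"
    using inv' gen' \<Delta> y wp' by (rule iso_transition_group)
  moreover have "group G" "finite B"
    using gen fin by (auto simp: generated_by_def B_def)
  ultimately show ?thesis
    using inv' unfolding CF_TR_def by blast
qed

theorem theorem6p1:
  fixes G :: "('g, 'm) monoid_scheme"
    and A :: "'a set" and \<iota> :: "'a \<Rightarrow> 'a" and \<pi> :: "'a \<Rightarrow> 'g"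
    and k :: nat
    and \<Gamma> :: "nat \<Rightarrow> ('a, 'v, 'e) labelled_graph" and x :: "nat \<Rightarrow> 'v"
  assumes "finite A" and "involutive_alphabet A \<iota>"
    and "generated_by G A \<iota> \<pi>"
    and "\<And>i. i < k \<Longrightarrow> A_graph A \<iota> (\<Gamma> i)"
    and "\<And>i. i < k \<Longrightarrow> x i \<in> verts (dgraph (\<Gamma> i))"
    and "\<And>i. i < k \<Longrightarrow> context_free (circuit_language (\<Gamma> i) (x i))"
    and "WP G A \<pi> = lists A \<inter> (\<Inter>i<k. circuit_language (\<Gamma> i) (x i))"
  shows "(\<forall>i<k. complete_A_graph A \<iota> (\<Gamma> i)) \<and>
         G \<cong> transition_group A \<iota> k \<Gamma> \<and>
         CF_TR G"
proof (intro conjI allI impI)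
  show "complete_A_graph A \<iota> (\<Gamma> i)" if "i < k" for i
    using assms(2,3) assms(4,5)[OF that]
    by (rule complete_if_word_problem_subset) (use assms(7) that in blast)
  show "G \<cong> transition_group A \<iota> k \<Gamma>"
    using assms(2-5,7) by (rule iso_transition_group)
  show "CF_TR G"
    using assms by (rule CF_TR_if_word_problem_INT)
qed

end
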